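(* Let $G_1, G_2$ be two non-isomorphic graphs on $k_1, k_2$ vertices, respectively. Then: (1) If we write $X_{G_1}^{G_1} = \sum_{\lambda \vdash k_1} c_\lambda m_\lambda^{k_1}$, then $c_{(1^{k_1})}$ is the number of automorphisms of $G_1$. (2) If we write $X_{G_1}^{G_2} = \sum_{\lambda \vdash k_1} c_\lambda m_\lambda$, then $c_{(1^{k_1})} = 0$ whenever either $k_1 > k_2$, or $k_1 = k_2$ and $|E(G_1)| \geq |E(G_2)|$. (3) There exists a graph $H$ such that $X_{G_1}^H \neq X_{G_2}^H$.
   Context: All graphs are finite, simple, undirected, with at least one vertex. For a partition $\lambda$, $l(\lambda)$ is its number of parts and $r_i(\lambda)$ the number of parts equal to $i$; $m_\lambda$ is the monomial symmetric function; $(1^k)$ is the partition of $k$ into $k$ ones. $H$-chromatic symmetric function: let $G,H$ be graphs with $|V(G)|=k$, $|V(H)|=n$. A labeling of $H$ is a bijection $\phi:V(H)\to[n]$. A proper $(H,\phi)$-coloring of $G$ is a map $\kappa:V(G)\to[n]$ such that whenever $u,v$ are adjacent in $G$, $\phi^{-1}(\kappa(u))$ and $\phi^{-1}(\kappa(v))$ are adjacent in $H$. Put $w_G^H=\sum_\phi\sum_\kappa\prod_{v\in V(G)}x_{\kappa(v)}$, summed over all labelings $\phi$ and all proper $(H,\phi)$-colorings $\kappa$. This is a symmetric polynomial in $x_1,\dots,x_n$, homogeneous of degree $k$; writing $w_G^H=\sum_{\lambda\vdash k,\,l(\lambda)\le n}c_\lambda m_\lambda(x_1,\dots,x_n)$,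 define $X_G^H=\sum_{\lambda\vdash k,\,l(\lambda)\le n}c_\lambda m_\lambda\in\Lambda^k$ (so $X_G^H=0$ if there are no proper colorings). For $l(\lambda)\le n$, $\lambda\vdash k$, the $n$-augmented monomial is $m_\lambda^n=\left(\prod_{i=1}^k r_i(\lambda)!\right)(n-l(\lambda))!\,m_\lambda$. In an expansion of $X_G^H$ in terms of $m_\lambda^{n}$ with $n=|V(H)|$, terms with $l(\lambda)>n$ are taken to have coefficient $0$. *)

theory Defs
  imports Complex_Main "HOL-Library.FuncSet" "HOL-Library.Multiset" "HOL-Library.Poly_Mapping"
begin

record 'a ugraph =
  verts :: "'a set"
  edges :: "'a set set"

definition simple_graph :: "'a ugraph \<Rightarrow> bool" where
  "simple_graph G \<longleftrightarrow> finite (verts G) \<and> verts G \<noteq> {} \<and>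
     edges G \<subseteq> {e. e \<subseteq> verts G \<and> card e = 2}"

definition adj :: "'a ugraph \<Rightarrow> 'a \<Rightarrow> 'a \<Rightarrow> bool" where
  "adj G u v \<longleftrightarrow> {u, v} \<in> edges G"

definition graph_iso :: "'a ugraph \<Rightarrow> 'b ugraph \<Rightarrow> ('a \<Rightarrow> 'b) \<Rightarrow> bool" where
  "graph_iso G H f \<longleftrightarrow> bij_betw f (verts G) (verts H) \<and>
     (\<forall>u\<in>verts G. \<forall>v\<in>verts G. adj G u v \<longleftrightarrow> adj H (f u) (f v))"

definition isomorphic :: "'a ugraph \<Rightarrow> 'b ugraph \<Rightarrow> bool" where
  "isomorphic G H \<longleftrightarrow> (\<exists>f. graph_iso G H f)"

text \<open>Maps out of a vertex set are taken to be extensional, so that each is counted once.\<close>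

definition automorphisms :: "'a ugraph \<Rightarrow> ('a \<Rightarrow> 'a) set" where
  "automorphisms G = {f \<in> extensional (verts G). graph_iso G G f}"

definition labelings :: "'a ugraph \<Rightarrow> ('a \<Rightarrow> nat) set" where
  "labelings H = {\<phi> \<in> extensional (verts H). bij_betw \<phi> (verts H) {1..card (verts H)}}"

definition proper_colorings :: "'a ugraph \<Rightarrow> 'b ugraph \<Rightarrow> ('b \<Rightarrow> nat) \<Rightarrow> ('a \<Rightarrow> nat) set" where
  "proper_colorings G H \<phi> = {\<kappa> \<in> verts G \<rightarrow>\<^sub>E {1..card (verts H)}.
     \<forall>u\<in>verts G. \<forall>v\<in>verts G. adj G u v \<longrightarrow>
       adj H (inv_into (verts H) \<phi> (\<kappa> u)) (inv_into (verts H) \<phi> (\<kappa> v))}"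

text \<open>A monomial in $x_0, x_1, x_2, \dots$ is its exponent vector, of type \<open>nat \<Rightarrow>\<^sub>0 nat\<close>.
  Polynomials are finitely supported, and formal power series arbitrary, rational-valued
  functions on exponent vectors. Only the variables $x_i$ with $i \ge 1$ are used.
  A partition is the multiset of its parts.\<close>

type_synonym rpoly = "(nat \<Rightarrow>\<^sub>0 nat) \<Rightarrow>\<^sub>0 rat"
type_synonym rseries = "(nat \<Rightarrow>\<^sub>0 nat) \<Rightarrow> rat"

definition var :: "nat \<Rightarrow> rpoly" where
  "var i = Poly_Mapping.single (Poly_Mapping.single i 1) 1"

definition const :: "rat \<Rightarrow> rpoly" where
  "const a = Poly_Mapping.single 0 a"

definition partitions :: "nat \<Rightarrow> nat multiset set" where
  "partitions k = {p. 0 \<notin># p \<and> sum_mset p = k}"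

definition ones :: "nat \<Rightarrow> nat multiset" where
  "ones k = replicate_mset k 1"

definition exponents :: "(nat \<Rightarrow>\<^sub>0 nat) \<Rightarrow> nat multiset" where
  "exponents \<alpha> = image_mset (Poly_Mapping.lookup \<alpha>) (mset_set (Poly_Mapping.keys \<alpha>))"

definition mono_poly :: "nat \<Rightarrow> nat multiset \<Rightarrow> rpoly" where
  "mono_poly n p = (\<Sum>\<alpha> | Poly_Mapping.keys \<alpha> \<subseteq> {1..n} \<and> exponents \<alpha> = p. Poly_Mapping.single \<alpha> 1)"

definition mono_sym :: "nat multiset \<Rightarrow> rseries" where
  "mono_sym p \<alpha> = (if Poly_Mapping.keys \<alpha> \<subseteq> {1..} \<and> exponents \<alpha> = p then 1 else 0)"

text \<open>Meaningful only for \<open>size p \<le> n\<close>, because of the truncated subtraction.\<close>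

definition aug_mono_sym :: "nat \<Rightarrow> nat multiset \<Rightarrow> rseries" where
  "aug_mono_sym n p \<alpha> =
     (\<Prod>i = 1..sum_mset p. fact (count p i)) * fact (n - size p) * mono_sym p \<alpha>"

definition w_poly :: "'a ugraph \<Rightarrow> 'b ugraph \<Rightarrow> rpoly" where
  "w_poly G H = (\<Sum>\<phi>\<in>labelings H. \<Sum>\<kappa>\<in>proper_colorings G H \<phi>. \<Prod>v\<in>verts G. var (\<kappa> v))"

text \<open>The description is well defined: \<open>w_poly G H\<close> is symmetric in $x_1, \dots, x_n$ and
  homogeneous, and the polynomials \<open>mono_poly n p\<close> with \<open>size p \<le> n\<close> are linearly
  independent.\<close>

definition chrom_sym :: "'a ugraph \<Rightarrow> 'b ugraph \<Rightarrow> rseries" where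
  "chrom_sym G H = (THE X. \<exists>c.
     w_poly G H = (\<Sum>p | p \<in> partitions (card (verts G)) \<and> size p \<le> card (verts H).
                     const (c p) * mono_poly (card (verts H)) p) \<and>
     X = (\<lambda>\<alpha>. \<Sum>p | p \<in> partitions (card (verts G)) \<and> size p \<le> card (verts H).
                     c p * mono_sym p \<alpha>))"

end

theory Submission
  imports Defs "HOL-Combinatorics.Permutations"
begin

text \<open>
  Writing a proper coloring as \<open>\<kappa> = \<phi> \<circ> f\<close> with \<open>f\<close> a homomorphism from \<open>G\<close> to \<open>H\<close> separates the
  labeling from the coloring: the coefficient of a monomial in \<open>w_poly G H\<close> counts pairs of a
  homomorphism \<open>f\<close> and a labeling \<open>\<phi>\<close>. Permuting the labels gives symmetry. If \<open>G\<close> and \<open>H\<close> both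
  have \<open>n\<close> vertices, then \<open>\<phi> \<circ> f\<close> has monomial $x_1 \cdots x_n$ exactly when \<open>f\<close> is injective, so that
  coefficient is \<open>n!\<close> times the number of bijective homomorphisms. A bijective homomorphism onto a
  graph with no more edges is an isomorphism.
\<close>

section \<open>Exponent vectors and partitions\<close>

lemma size_le_of_partition: "p \<in> partitions k \<Longrightarrow> size p \<le> k"
proof -
  have "0 \<notin># p \<Longrightarrow> size p \<le> sum_mset p"
    by (induction p) auto
  then show "p \<in> partitions k \<Longrightarrow> size p \<le> k"
    by (auto simp: partitions_def)
qed

text \<open>All parts are positive, so a partition of k comes from a list of length at most k with
  entries at most k. Finiteness keeps the sums over partitions from collapsing to the default value
  0.\<close>

lemma finite_partitions [simp]: "finite (partitions k)"
proof -
  have "partitions k \<subseteq> mset ` {xs. set xs \<subseteq> {..k} \<and> length xs \<le> k}"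
  proof
    fix p assume p: "p \<in> partitions k"
    obtain xs where xs: "mset xs = p"
      using ex_mset by blast
    have "length xs \<le> k"
      using size_le_of_partition[OF p] xs by auto
    moreover have "x \<le> k" if "x \<in> set xs" for x
      using p xs that by (auto simp: partitions_def sum_mset_sum_list member_le_sum_list)
    ultimately show "p \<in> mset ` {xs. set xs \<subseteq> {..k} \<and> length xs \<le> k}"
      using xs by auto
  qed
  then show ?thesis
    by (rule finite_subset) (simp add: finite_lists_length_le)
qed

lemma ones_in_partitions: "ones k \<in> partitions k"
  by (auto simp: ones_def partitions_def)

lemma size_exponents: "size (exponents \<alpha>) = card (Poly_Mapping.keys \<alpha>)"
  by (simp add: exponents_def)

lemma zero_notin_exponents: "0 \<notin># exponents \<alpha>"
  by (auto simp: exponents_def in_keys_iff)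

lemma sum_mset_exponents:
  assumes "finite A" "Poly_Mapping.keys \<alpha> \<subseteq> A"
  shows "sum_mset (exponents \<alpha>) = (\<Sum>i\<in>A. Poly_Mapping.lookup \<alpha> i)"
proof -
  have "sum_mset (exponents \<alpha>) = (\<Sum>i\<in>Poly_Mapping.keys \<alpha>. Poly_Mapping.lookup \<alpha> i)"
    by (simp add: exponents_def sum_unfold_sum_mset)
  also have "\<dots> = (\<Sum>i\<in>A. Poly_Mapping.lookup \<alpha> i)"
    using assms by (intro sum.mono_neutral_left) (auto simp: in_keys_iff)
  finally show ?thesis .
qed

text \<open>Padding with zeros for the absent variables puts vectors of different supports on the
  common index set \<open>A\<close>, where a permutation can compare them.\<close>

lemma image_mset_lookup:
  assumes "finite A" "Poly_Mapping.keys \<alpha> \<subseteq> A"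
  shows "image_mset (Poly_Mapping.lookup \<alpha>) (mset_set A) =
    exponents \<alpha> + replicate_mset (card A - size (exponents \<alpha>)) 0"
proof -
  let ?K = "Poly_Mapping.keys \<alpha>"
  have "mset_set A = mset_set ?K + mset_set (A - ?K)"
    using assms by (metis Diff_disjoint Diff_partition finite_Diff finite_keys mset_set_Union)
  moreover have "image_mset (Poly_Mapping.lookup \<alpha>) (mset_set (A - ?K)) =
      image_mset (\<lambda>_. 0) (mset_set (A - ?K))"
    using assms by (intro image_mset_cong) (auto simp: in_keys_iff)
  ultimately show ?thesis
    using assms by (simp add: exponents_def image_mset_const_eq card_Diff_subset)
qed

text \<open>Equal multisets of values on \<open>A\<close> differ by a rearrangement of
  \<open>A\<close>. This is how monomials of the same shape are linked by renaming
  variables.\<close>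

lemma exponents_eq_imp_permutes:
  assumes "finite A" "Poly_Mapping.keys \<alpha> \<subseteq> A" "Poly_Mapping.keys \<beta> \<subseteq> A"
    and "exponents \<alpha> = exponents \<beta>"
  obtains \<sigma> where "\<sigma> permutes A" "\<And>i. Poly_Mapping.lookup \<beta> (\<sigma> i) = Poly_Mapping.lookup \<alpha> i"
proof -
  have "image_mset (Poly_Mapping.lookup \<alpha>) (mset_set A) =
      image_mset (Poly_Mapping.lookup \<beta>) (mset_set A)"
    using assms by (simp add: image_mset_lookup)
  then obtain \<sigma> where \<sigma>: "\<sigma> permutes A"
      "\<forall>i\<in>A. Poly_Mapping.lookup \<alpha> i = Poly_Mapping.lookup \<beta> (\<sigma> i)"
    using image_mset_eq_implies_permutes[OF assms(1)] by metis
  have "Poly_Mapping.lookup \<beta> (\<sigma> i) = Poly_Mapping.lookup \<alpha> i" for i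
  proof (cases "i \<in> A")
    \<comment> \<open>Outside \<open>A\<close> the permutation is the identity and both vectors
      vanish.\<close>
    case False
    then show ?thesis
      using assms \<sigma>(1) by (metis in_keys_iff permutes_not_in subsetD)
  qed (use \<sigma> in simp)
  with \<sigma>(1) show ?thesis ..
qed

text \<open>Every shape with at most n parts is realized in n variables. Such a monomial serves as a
  probe for reading off the coefficient belonging to the shape.\<close>

lemma ex_exponents:
  assumes "0 \<notin># p" "size p \<le> n"
  shows "\<exists>\<alpha>. Poly_Mapping.keys \<alpha> \<subseteq> {1..n} \<and> exponents \<alpha> = p"
proof -
  obtain xs where xs: "mset xs = p"
    using ex_mset by blast
  \<comment> \<open>The parts become the exponents of the first variables; the shift by 1 arises
    because list positions start at 0 and variables at 1.\<close>
  define f where "f i = (if i \<in> {1..length xs} then xs ! (i - 1) else 0)" for i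
  define \<alpha> where "\<alpha> = Poly_Mapping.Abs_poly_mapping f"
  have "finite {i. f i \<noteq> 0}"
    by (rule finite_subset[of _ "{1..length xs}"]) (auto simp: f_def)
  then have lookup: "Poly_Mapping.lookup \<alpha> = f"
    by (simp add: \<alpha>_def)
  have "xs ! (i - 1) \<noteq> 0" if "i \<in> {1..length xs}" for i
  proof -
    have "xs ! (i - 1) \<in> set xs"
      using that by (intro nth_mem) auto
    then show ?thesis
      using assms(1) xs by (metis set_mset_mset)
  qed
  then have keys: "Poly_Mapping.keys \<alpha> = {1..length xs}"
    unfolding set_eq_iff in_keys_iff lookup f_def by auto
  have "map f [1..<Suc (length xs)] = xs"
    by (rule nth_equalityI) (auto simp: f_def simp del: upt_Suc)
  then have "exponents \<alpha> = p"
    using xs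
    by (metis atLeastLessThanSuc_atLeastAtMost exponents_def keys lookup mset_map mset_upt)
  moreover have "Poly_Mapping.keys \<alpha> \<subseteq> {1..n}"
    using keys assms(2) xs by auto
  ultimately show ?thesis
    by blast
qed

text \<open>Each exponent is bounded by the sum of the parts, so restriction to {1..n} embeds these
  vectors in a finite function space. Without finiteness the sum defining \<open>mono_poly\<close>
  would be 0 by default.\<close>

lemma finite_exponents_eq: "finite {\<alpha>. Poly_Mapping.keys \<alpha> \<subseteq> {1..n} \<and> exponents \<alpha> = p}"
  (is "finite ?S")
proof (rule inj_on_finite[where f = "\<lambda>\<alpha>. restrict (Poly_Mapping.lookup \<alpha>) {1..n}"])
  show "inj_on (\<lambda>\<alpha>. restrict (Poly_Mapping.lookup \<alpha>) {1..n}) ?S"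
  proof (rule inj_onI, rule poly_mapping_eqI)
    fix \<alpha> \<beta> i
    assume S: "\<alpha> \<in> ?S" "\<beta> \<in> ?S"
      and eq: "restrict (Poly_Mapping.lookup \<alpha>) {1..n} = restrict (Poly_Mapping.lookup \<beta>) {1..n}"
    show "Poly_Mapping.lookup \<alpha> i = Poly_Mapping.lookup \<beta> i"
    proof (cases "i \<in> {1..n}")
      case True
      then show ?thesis
        using fun_cong[OF eq, of i] by simp
    next
      case False
      then have "i \<notin> Poly_Mapping.keys \<alpha>" "i \<notin> Poly_Mapping.keys \<beta>"
        using S by blast+
      then show ?thesis
        by (simp add: not_in_keys_iff_lookup_eq_zero)
    qed
  qed
  have "Poly_Mapping.lookup \<alpha> i \<le> sum_mset p" if "\<alpha> \<in> ?S" "i \<in> {1..n}" for \<alpha> i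
    using that sum_mset_exponents[of "{1..n}" \<alpha>]
      member_le_sum[of i "{1..n}" "Poly_Mapping.lookup \<alpha>"] by auto
  then show "(\<lambda>\<alpha>. restrict (Poly_Mapping.lookup \<alpha>) {1..n}) ` ?S \<subseteq> {1..n} \<rightarrow>\<^sub>E {..sum_mset p}"
    by (auto simp: image_subset_iff)
  show "finite ({1..n} \<rightarrow>\<^sub>E {..sum_mset p})"
    by (intro finite_PiE) auto
qed

lemma lookup_const_mult_mono_poly:
  "Poly_Mapping.lookup (const a * mono_poly n p) \<alpha> =
    (if Poly_Mapping.keys \<alpha> \<subseteq> {1..n} \<and> exponents \<alpha> = p then a else 0)"
proof -
  have "Poly_Mapping.lookup (const a * mono_poly n p) \<alpha> =
      (\<Sum>\<beta> | Poly_Mapping.keys \<beta> \<subseteq> {1..n} \<and> exponents \<beta> = p. if \<beta> = \<alpha> then a else 0)"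
    by (simp add: const_def mono_poly_def sum_distrib_left mult_single lookup_sum lookup_single
        when_def)
  then show ?thesis
    using sum.delta[OF finite_exponents_eq, of \<alpha> "\<lambda>_. a" n p] by simp
qed

text \<open>A monomial has exactly one shape, so at most one summand survives.\<close>

lemma sum_mult_mono_sym:
  assumes "finite P"
  shows "(\<Sum>p\<in>P. c p * mono_sym p \<alpha>) =
    (if Poly_Mapping.keys \<alpha> \<subseteq> {1..} \<and> exponents \<alpha> \<in> P then c (exponents \<alpha>) else 0)"
proof (cases "Poly_Mapping.keys \<alpha> \<subseteq> {1..}")
  case True
  then have "(\<Sum>p\<in>P. c p * mono_sym p \<alpha>) = (\<Sum>p\<in>P. if p = exponents \<alpha> then c p else 0)"
    by (intro sum.cong) (auto simp: mono_sym_def)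
  then show ?thesis
    using assms True by simp
qed (auto simp: mono_sym_def)

lemma lookup_sum_mono_poly:
  assumes "finite P"
  shows "Poly_Mapping.lookup (\<Sum>p\<in>P. const (c p) * mono_poly n p) \<alpha> =
    (if Poly_Mapping.keys \<alpha> \<subseteq> {1..n} \<and> exponents \<alpha> \<in> P then c (exponents \<alpha>) else 0)"
proof (cases "Poly_Mapping.keys \<alpha> \<subseteq> {1..n}")
  case True
  then have "Poly_Mapping.lookup (\<Sum>p\<in>P. const (c p) * mono_poly n p) \<alpha> =
      (\<Sum>p\<in>P. if p = exponents \<alpha> then c p else 0)"
    by (auto simp: lookup_sum lookup_const_mult_mono_poly intro!: sum.cong)
  then show ?thesis
    using assms True by simp
qed (auto simp: lookup_sum lookup_const_mult_mono_poly)

section \<open>Exponent vectors of colorings\<close>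

definition weight :: "'a set \<Rightarrow> ('a \<Rightarrow> nat) \<Rightarrow> nat \<Rightarrow>\<^sub>0 nat" where
  "weight V \<kappa> = (\<Sum>v\<in>V. Poly_Mapping.single (\<kappa> v) 1)"

lemma prod_var_eq_single:
  "finite V \<Longrightarrow> (\<Prod>v\<in>V. var (\<kappa> v)) = Poly_Mapping.single (weight V \<kappa>) 1"
  by (induction V rule: finite_induct) (auto simp: weight_def var_def mult_single)

lemma lookup_weight:
  assumes "finite V"
  shows "Poly_Mapping.lookup (weight V \<kappa>) i = card {v \<in> V. \<kappa> v = i}"
  using assms
  by (simp add: weight_def lookup_sum lookup_single when_def flip: sum.inter_filter)

lemma keys_weight: "finite V \<Longrightarrow> Poly_Mapping.keys (weight V \<kappa>) = \<kappa> ` V"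
  by (auto simp: in_keys_iff lookup_weight)

lemma weight_cong: "(\<And>v. v \<in> V \<Longrightarrow> \<kappa> v = \<kappa>' v) \<Longrightarrow> weight V \<kappa> = weight V \<kappa>'"
  by (simp add: weight_def)

text \<open>The exponents are the sizes of the color classes, and these classes partition
  \<open>V\<close>.\<close>

lemma sum_mset_exponents_weight:
  assumes "finite V"
  shows "sum_mset (exponents (weight V \<kappa>)) = card V"
  using assms sum.image_gen[OF assms, of "\<lambda>_. 1::nat" \<kappa>]
  by (simp add: sum_mset_exponents[of "\<kappa> ` V"] keys_weight lookup_weight)

text \<open>Recoloring by \<sigma> only renames color classes: the class of
  \<open>\<sigma> i\<close> under \<open>\<sigma> \<circ> \<kappa>\<close> is the class of
  \<open>i\<close> under \<kappa>.\<close>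

lemma weight_comp_permutes:
  assumes "finite V" "\<sigma> permutes A"
    and "\<And>i. Poly_Mapping.lookup \<beta> (\<sigma> i) = Poly_Mapping.lookup \<alpha> i"
  shows "weight V (\<sigma> \<circ> \<kappa>) = \<beta> \<longleftrightarrow> weight V \<kappa> = \<alpha>"
proof -
  have inj: "\<sigma> (\<kappa> v) = \<sigma> i \<longleftrightarrow> \<kappa> v = i" for v i
    using permutes_inj[OF assms(2)] by (auto dest: injD)
  have "weight V (\<sigma> \<circ> \<kappa>) = \<beta> \<longleftrightarrow>
      (\<forall>i. card {v \<in> V. \<sigma> (\<kappa> v) = i} = Poly_Mapping.lookup \<beta> i)"
    using assms(1) by (simp add: poly_mapping_eq_iff fun_eq_iff lookup_weight)
  \<comment> \<open>Since \<sigma> is onto, it suffices to test the colors of the form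
    \<open>\<sigma> i\<close>.\<close>
  also have "\<dots> \<longleftrightarrow> (\<forall>i. card {v \<in> V. \<sigma> (\<kappa> v) = \<sigma> i} = Poly_Mapping.lookup \<beta> (\<sigma> i))"
    using permutes_surj[OF assms(2)] by (metis surjD)
  also have "\<dots> \<longleftrightarrow> weight V \<kappa> = \<alpha>"
    using assms(1,3) by (simp add: poly_mapping_eq_iff fun_eq_iff lookup_weight inj)
  finally show ?thesis .
qed

definition ones_vector :: "nat \<Rightarrow> nat \<Rightarrow>\<^sub>0 nat" where
  "ones_vector n = weight {1..n} id"

lemma keys_ones_vector: "Poly_Mapping.keys (ones_vector n) = {1..n}"
  by (simp add: ones_vector_def keys_weight)

lemma exponents_ones_vector: "exponents (ones_vector n) = ones n"
proof -
  have "image_mset (Poly_Mapping.lookup (ones_vector n)) (mset_set {1..n}) =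
      image_mset (\<lambda>_. 1) (mset_set {1..n})"
  proof (intro image_mset_cong)
    fix i assume "i \<in># mset_set {1..n}"
    then have "{v \<in> {1..n}. v = i} = {i}"
      by auto
    then show "Poly_Mapping.lookup (ones_vector n) i = 1"
      by (simp add: ones_vector_def lookup_weight)
  qed
  then show ?thesis
    by (simp only: exponents_def keys_ones_vector) (simp add: ones_def image_mset_const_eq)
qed

text \<open>Forward, the support gives the image {1..n} and the degree gives
  \<open>card V = n\<close>, so the surjection is injective. Backward, the sum is reindexed along
  the bijection.\<close>

lemma weight_eq_ones_vector_iff:
  assumes "finite V"
  shows "weight V \<kappa> = ones_vector n \<longleftrightarrow> bij_betw \<kappa> V {1..n}"
proof
  assume eq: "weight V \<kappa> = ones_vector n"
  then have img: "\<kappa> ` V = {1..n}"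
    using keys_weight[OF assms, of \<kappa>] keys_ones_vector[of n] by metis
  moreover have "card V = n"
    using sum_mset_exponents_weight[OF assms, of \<kappa>] eq exponents_ones_vector[of n]
    by (simp add: ones_def)
  ultimately show "bij_betw \<kappa> V {1..n}"
    using assms by (simp add: bij_betw_def eq_card_imp_inj_on)
next
  assume "bij_betw \<kappa> V {1..n}"
  then show "weight V \<kappa> = ones_vector n"
    unfolding ones_vector_def weight_def id_apply by (rule sum.reindex_bij_betw)
qed

section \<open>Homomorphisms and colorings\<close>

definition homs :: "'a ugraph \<Rightarrow> 'b ugraph \<Rightarrow> ('a \<Rightarrow> 'b) set" where
  "homs G H = {f \<in> verts G \<rightarrow>\<^sub>E verts H.
     \<forall>u\<in>verts G. \<forall>v\<in>verts G. adj G u v \<longrightarrow> adj H (f u) (f v)}"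

lemma finite_homs: "finite (verts G) \<Longrightarrow> finite (verts H) \<Longrightarrow> finite (homs G H)"
  unfolding homs_def by (intro finite_subset[OF _ finite_PiE[of "verts G" "\<lambda>_. verts H"]]) auto

lemma graph_iso_imp_hom:
  assumes "graph_iso G H f"
  shows "restrict f (verts G) \<in> homs G H"
  using assms by (auto simp: homs_def graph_iso_def bij_betw_def)

lemma bij_betw_of_card_eq:
  assumes "f \<in> A \<rightarrow> B" "inj_on f A" "finite B" "card A = card B"
  shows "bij_betw f A B"
proof -
  have "f ` A = B"
    using assms by (intro card_subset_eq) (auto simp: card_image)
  then show ?thesis
    using assms(2) by (simp add: bij_betw_def)
qed

text \<open>An injective homomorphism embeds the edges; if there are no fewer edges in the source, it
  hits every edge and hence reflects adjacency.\<close>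

lemma inj_hom_imp_iso:
  assumes "simple_graph G" "simple_graph H" "f \<in> homs G H" "inj_on f (verts G)"
    and "card (verts G) = card (verts H)" "card (edges G) \<ge> card (edges H)"
  shows "graph_iso G H f"
proof -
  have hom: "f \<in> verts G \<rightarrow> verts H"
      "\<And>u v. u \<in> verts G \<Longrightarrow> v \<in> verts G \<Longrightarrow> adj G u v \<Longrightarrow> adj H (f u) (f v)"
    using assms(3) by (auto simp: homs_def)
  have G: "edges G \<subseteq> Pow (verts G)" and "finite (verts H)" and H: "edges H \<subseteq> Pow (verts H)"
    using assms(1,2) by (auto simp: simple_graph_def)
  then have finE: "finite (edges H)"
    by (meson finite_Pow_iff finite_subset)
  have inj: "inj_on (image f) (Pow (verts G))"
    by (rule inj_on_image_Pow[OF assms(4)])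
  have "(`) f ` edges G \<subseteq> edges H"
  proof
    fix e' assume "e' \<in> (`) f ` edges G"
    then obtain e where e: "e \<in> edges G" "e' = f ` e"
      by blast
    then have "card e = 2"
      using assms(1) by (auto simp: simple_graph_def)
    then obtain u v where "e = {u, v}"
      by (auto simp: card_2_iff)
    then show "e' \<in> edges H"
      using hom(2)[of u v] e G by (auto simp: adj_def)
  qed
  moreover have "card ((`) f ` edges G) = card (edges G)"
    using inj_on_subset[OF inj G] by (rule card_image)
  ultimately have img: "(`) f ` edges G = edges H"
    using assms(6) finE by (metis card_seteq)
  have "adj G u v" if "u \<in> verts G" "v \<in> verts G" "adj H (f u) (f v)" for u v
  proof -
    have "f ` {u, v} \<in> (`) f ` edges G"
      using that(3) img by (simp add: adj_def)
    then obtain e where e: "e \<in> edges G" "f ` e = f ` {u, v}"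
      by (metis imageE)
    then have "e = {u, v}"
      using inj_onD[OF inj e(2)] G that by auto
    then show ?thesis
      using e by (simp add: adj_def)
  qed
  then show ?thesis
    using hom assms(4,5) \<open>finite (verts H)\<close>
    by (auto simp: graph_iso_def intro: bij_betw_of_card_eq)
qed

text \<open>Source and target have equally many edges, so an injective endomorphism is already an
  isomorphism. This turns the count of injective homomorphisms into a count of
  automorphisms.\<close>

lemma automorphisms_eq_inj_homs:
  assumes "simple_graph G"
  shows "automorphisms G = {f \<in> homs G G. inj_on f (verts G)}"
proof (intro equalityI subsetI)
  fix f assume f: "f \<in> automorphisms G"
  then have "restrict f (verts G) = f"
    by (simp add: automorphisms_def extensional_restrict)
  then show "f \<in> {f \<in> homs G G. inj_on f (verts G)}"
    using f graph_iso_imp_hom[of G G f] by (auto simp: automorphisms_def graph_iso_def bij_betw_def)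
next
  fix f assume "f \<in> {f \<in> homs G G. inj_on f (verts G)}"
  then show "f \<in> automorphisms G"
    using inj_hom_imp_iso[OF assms assms, of f] by (auto simp: automorphisms_def homs_def PiE_def)
qed

text \<open>The distinguishing graph has to live on natural numbers, whereas the given graphs have
  arbitrary vertex types; a copy transported along an injection bridges the gap.\<close>

lemma ex_nat_copy:
  assumes "simple_graph G"
  shows "\<exists>H :: nat ugraph. simple_graph H \<and> card (verts H) = card (verts G) \<and>
    card (edges H) = card (edges G) \<and> (\<exists>f. graph_iso G H f)"
proof -
  have fin: "finite (verts G)" and G: "edges G \<subseteq> Pow (verts G)"
    using assms by (auto simp: simple_graph_def)
  obtain f :: "_ \<Rightarrow> nat" where f: "inj_on f (verts G)"
    using finite_imp_inj_to_nat_seg[OF fin] by blast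
  define H where "H = \<lparr>verts = f ` verts G, edges = (`) f ` edges G\<rparr>"
  have inj: "inj_on (image f) (Pow (verts G))"
    by (rule inj_on_image_Pow[OF f])
  have "card (f ` e) = 2 \<and> f ` e \<subseteq> f ` verts G" if "e \<in> edges G" for e
  proof -
    have "e \<subseteq> verts G" "card e = 2"
      using assms that by (auto simp: simple_graph_def)
    then show ?thesis
      using card_image[OF inj_on_subset[OF f]] by auto
  qed
  then have "simple_graph H"
    using assms by (auto simp: simple_graph_def H_def)
  moreover have "card (verts H) = card (verts G)" "card (edges H) = card (edges G)"
    using card_image[OF f] card_image[OF inj_on_subset[OF inj G]] by (auto simp: H_def)
  moreover have "adj G u v \<longleftrightarrow> adj H (f u) (f v)" if "u \<in> verts G" "v \<in> verts G" for u v
  proof -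
    have "f ` {u, v} \<in> (`) f ` edges G \<longleftrightarrow> {u, v} \<in> edges G"
      using that G by (intro inj_on_image_mem_iff[OF inj]) auto
    then show ?thesis
      by (simp add: adj_def H_def)
  qed
  then have "graph_iso G H f"
    using f by (auto simp: graph_iso_def H_def bij_betw_def)
  ultimately show ?thesis
    by blast
qed

section \<open>Labelings and the coefficients of \<open>w_poly\<close>\<close>

lemma labelings_eq:
  assumes "finite (verts H)"
  shows "labelings H = {\<phi> \<in> verts H \<rightarrow>\<^sub>E {1..card (verts H)}. inj_on \<phi> (verts H)}"
proof -
  have "bij_betw \<phi> (verts H) {1..card (verts H)} \<longleftrightarrow>
      \<phi> \<in> verts H \<rightarrow> {1..card (verts H)} \<and> inj_on \<phi> (verts H)" for \<phi>
    using bij_betw_of_card_eq[of \<phi> "verts H" "{1..card (verts H)}"]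
    using assms bij_betw_imp_funcset bij_betw_imp_inj_on by fastforce
  then show ?thesis
    unfolding labelings_def PiE_def by blast
qed

lemma finite_labelings: "finite (verts H) \<Longrightarrow> finite (labelings H)"
  by (simp add: labelings_eq finite_PiE)

lemma card_labelings:
  assumes "finite (verts H)"
  shows "card (labelings H) = fact (card (verts H))"
proof -
  have "card (labelings H) = (\<Prod>i = 0..<card (verts H). card (verts H) - i)"
    using card_inj_on_subset_funcset[OF assms, of "{1..card (verts H)}" "verts H"]
    by (simp add: labelings_eq[OF assms])
  then show ?thesis
    by (simp add: fact_prod_rev)
qed

text \<open>The inverse sends \<kappa> to its composite with the inverse of \<phi>. The restrictions
  keep both sides extensional, so the correspondence is one to one.\<close>

lemma bij_betw_homs_proper_colorings:
  assumes "\<phi> \<in> labelings H"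
  shows "bij_betw (\<lambda>f. restrict (\<phi> \<circ> f) (verts G)) (homs G H) (proper_colorings G H \<phi>)"
proof -
  have \<phi>: "bij_betw \<phi> (verts H) {1..card (verts H)}"
    using assms by (simp add: labelings_def)
  let ?inv = "inv_into (verts H) \<phi>"
  have left: "?inv (\<phi> x) = x" if "x \<in> verts H" for x
    using \<phi> that by (rule bij_betw_inv_into_left)
  have right: "\<phi> (?inv i) = i" if "i \<in> {1..card (verts H)}" for i
    using \<phi> that by (rule bij_betw_inv_into_right)
  have mem: "\<phi> x \<in> {1..card (verts H)}" if "x \<in> verts H" for x
    using \<phi> that by (rule bij_betwE[rule_format])
  have invmem: "?inv i \<in> verts H" if "i \<in> {1..card (verts H)}" for i
    using bij_betw_inv_into[OF \<phi>] that by (rule bij_betwE[rule_format])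
  show ?thesis
  proof (rule bij_betw_byWitness[where f' = "\<lambda>\<kappa>. restrict (?inv \<circ> \<kappa>) (verts G)"])
    show "\<forall>f\<in>homs G H. restrict (?inv \<circ> restrict (\<phi> \<circ> f) (verts G)) (verts G) = f"
      by (auto simp: homs_def fun_eq_iff PiE_def extensional_def Pi_iff left)
    show "\<forall>\<kappa>\<in>proper_colorings G H \<phi>. restrict (\<phi> \<circ> restrict (?inv \<circ> \<kappa>) (verts G)) (verts G) = \<kappa>"
      using right by (auto simp: proper_colorings_def fun_eq_iff PiE_def extensional_def Pi_iff)
    show "(\<lambda>f. restrict (\<phi> \<circ> f) (verts G)) ` homs G H \<subseteq> proper_colorings G H \<phi>"
      using mem by (auto simp: homs_def proper_colorings_def PiE_iff left)
    show "(\<lambda>\<kappa>. restrict (?inv \<circ> \<kappa>) (verts G)) ` proper_colorings G H \<phi> \<subseteq> homs G H"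
      using invmem by (auto simp: homs_def proper_colorings_def PiE_iff)
  qed
qed

text \<open>Once colorings are replaced by homomorphisms, the inner index set no longer depends on
  \<phi>, and the two sums can be exchanged.\<close>

lemma lookup_w_poly:
  assumes "finite (verts G)" "finite (verts H)"
  shows "Poly_Mapping.lookup (w_poly G H) \<alpha> =
    of_nat (\<Sum>f\<in>homs G H. card {\<phi> \<in> labelings H. weight (verts G) (\<phi> \<circ> f) = \<alpha>})"
proof -
  have "(\<Sum>\<kappa>\<in>proper_colorings G H \<phi>. Poly_Mapping.lookup (\<Prod>v\<in>verts G. var (\<kappa> v)) \<alpha>) =
      (\<Sum>f\<in>homs G H. if weight (verts G) (\<phi> \<circ> f) = \<alpha> then 1 else 0)"
    if "\<phi> \<in> labelings H" for \<phi>
  proof -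
    have "weight (verts G) (restrict (\<phi> \<circ> f) (verts G)) = weight (verts G) (\<phi> \<circ> f)" for f
      by (rule weight_cong) simp
    then show ?thesis
      using assms(1)
      by (simp add: prod_var_eq_single lookup_single when_def
          flip: sum.reindex_bij_betw[OF bij_betw_homs_proper_colorings[OF that, of G]])
  qed
  then have "Poly_Mapping.lookup (w_poly G H) \<alpha> =
      (\<Sum>\<phi>\<in>labelings H. \<Sum>f\<in>homs G H. if weight (verts G) (\<phi> \<circ> f) = \<alpha> then 1 else 0)"
    by (simp add: w_poly_def lookup_sum)
  also have "\<dots> = (\<Sum>f\<in>homs G H. \<Sum>\<phi>\<in>labelings H. if weight (verts G) (\<phi> \<circ> f) = \<alpha> then 1 else 0)"
    by (rule sum.swap)
  also have "\<dots> = of_nat (\<Sum>f\<in>homs G H. card {\<phi> \<in> labelings H. weight (verts G) (\<phi> \<circ> f) = \<alpha>})"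
    using finite_labelings[OF assms(2)] by (simp flip: sum.inter_filter)
  finally show ?thesis .
qed

text \<open>A nonzero coefficient is witnessed by a pair of a homomorphism and a labeling whose
  composite has weight \<alpha>; all three bounds follow from that composite.\<close>

lemma lookup_w_poly_nonzeroD:
  assumes "finite (verts G)" "finite (verts H)" "Poly_Mapping.lookup (w_poly G H) \<alpha> \<noteq> 0"
  shows "Poly_Mapping.keys \<alpha> \<subseteq> {1..card (verts H)}" "exponents \<alpha> \<in> partitions (card (verts G))"
    "size (exponents \<alpha>) \<le> card (verts H)"
proof -
  have "(\<Sum>f\<in>homs G H. card {\<phi> \<in> labelings H. weight (verts G) (\<phi> \<circ> f) = \<alpha>}) \<noteq> 0"
    using assms(3) unfolding lookup_w_poly[OF assms(1,2)]
    by (simp only: of_nat_eq_0_iff not_False_eq_True)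
  then obtain f where f: "f \<in> homs G H"
      "card {\<phi> \<in> labelings H. weight (verts G) (\<phi> \<circ> f) = \<alpha>} \<noteq> 0"
    by (rule sum.not_neutral_contains_not_neutral)
  then obtain \<phi> where \<phi>: "\<phi> \<in> labelings H" "weight (verts G) (\<phi> \<circ> f) = \<alpha>"
    by (metis (mono_tags, lifting) card.empty empty_Collect_eq)
  have "\<phi> ` verts H = {1..card (verts H)}" "f ` verts G \<subseteq> verts H"
    using \<phi>(1) f(1) by (auto simp: labelings_def homs_def bij_betw_def)
  then show keys: "Poly_Mapping.keys \<alpha> \<subseteq> {1..card (verts H)}"
    unfolding \<phi>(2)[symmetric] keys_weight[OF assms(1)] by (auto simp: image_subset_iff)
  show "exponents \<alpha> \<in> partitions (card (verts G))"
    using sum_mset_exponents_weight[OF assms(1), of "\<phi> \<circ> f"] \<phi>(2)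
    by (simp add: partitions_def zero_notin_exponents)
  show "size (exponents \<alpha>) \<le> card (verts H)"
    using card_mono[OF _ keys] by (simp add: size_exponents)
qed

text \<open>For a fixed homomorphism, composing labelings with a permutation \<sigma> that carries
  \<alpha> to \<beta> matches those counted at \<alpha> with those counted at \<beta>.\<close>

lemma lookup_w_poly_symmetric:
  assumes "finite (verts G)" "finite (verts H)"
    and "Poly_Mapping.keys \<alpha> \<subseteq> {1..card (verts H)}" "Poly_Mapping.keys \<beta> \<subseteq> {1..card (verts H)}"
    and "exponents \<alpha> = exponents \<beta>"
  shows "Poly_Mapping.lookup (w_poly G H) \<alpha> = Poly_Mapping.lookup (w_poly G H) \<beta>"
proof -
  let ?n = "card (verts H)"
  obtain \<sigma> where \<sigma>: "\<sigma> permutes {1..?n}"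
      "\<And>i. Poly_Mapping.lookup \<beta> (\<sigma> i) = Poly_Mapping.lookup \<alpha> i"
    using exponents_eq_imp_permutes[OF finite_atLeastAtMost assms(3-5)] by metis
  have inv: "\<And>i. Poly_Mapping.lookup \<alpha> (inv \<sigma> i) = Poly_Mapping.lookup \<beta> i"
    using \<sigma> by (metis permutes_inverses(1))
  have lab: "restrict (\<tau> \<circ> \<phi>) (verts H) \<in> labelings H"
    if "\<phi> \<in> labelings H" "\<tau> permutes {1..?n}" for \<tau> \<phi>
  proof -
    have "bij_betw (\<tau> \<circ> \<phi>) (verts H) {1..?n}"
      using that by (intro bij_betw_trans[OF _ permutes_imp_bij]) (auto simp: labelings_def)
    then show ?thesis
      by (simp add: labelings_def)
  qed
  have "card {\<phi> \<in> labelings H. weight (verts G) (\<phi> \<circ> f) = \<alpha>} =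
      card {\<phi> \<in> labelings H. weight (verts G) (\<phi> \<circ> f) = \<beta>}" (is "card ?A = card ?B")
    if f: "f \<in> homs G H" for f
  proof -
    \<comment> \<open>The values of \<open>f\<close> lie in \<open>verts H\<close>, so restricting
      the relabeling to \<open>verts H\<close> changes nothing.\<close>
    have w: "weight (verts G) (restrict (\<tau> \<circ> \<phi>) (verts H) \<circ> f) = weight (verts G) (\<tau> \<circ> (\<phi> \<circ> f))"
      for \<tau> \<phi>
      using f by (intro weight_cong) (auto simp: homs_def)
    have "bij_betw (\<lambda>\<phi>. restrict (\<sigma> \<circ> \<phi>) (verts H)) ?A ?B"
    proof (rule bij_betw_byWitness[where f' = "\<lambda>\<phi>. restrict (inv \<sigma> \<circ> \<phi>) (verts H)"])
      show "\<forall>\<phi>\<in>?A. restrict (inv \<sigma> \<circ> restrict (\<sigma> \<circ> \<phi>) (verts H)) (verts H) = \<phi>"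
        using \<sigma>(1) by (auto simp: labelings_def fun_eq_iff extensional_def permutes_inverses)
      show "\<forall>\<phi>\<in>?B. restrict (\<sigma> \<circ> restrict (inv \<sigma> \<circ> \<phi>) (verts H)) (verts H) = \<phi>"
        using \<sigma>(1) by (auto simp: labelings_def fun_eq_iff extensional_def permutes_inverses)
      show "(\<lambda>\<phi>. restrict (\<sigma> \<circ> \<phi>) (verts H)) ` ?A \<subseteq> ?B"
        using lab \<sigma> weight_comp_permutes[OF assms(1) \<sigma>] by (auto simp: w simp del: o_assoc)
      show "(\<lambda>\<phi>. restrict (inv \<sigma> \<circ> \<phi>) (verts H)) ` ?B \<subseteq> ?A"
        using lab permutes_inv[OF \<sigma>(1)]
          weight_comp_permutes[OF assms(1) permutes_inv[OF \<sigma>(1)] inv] by (auto simp: w)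
    qed
    then show ?thesis
      by (rule bij_betw_same_card)
  qed
  then show ?thesis
    using assms(1,2) by (simp add: lookup_w_poly)
qed

text \<open>Each homomorphism contributes all n! labelings or none: equal vertex counts make an
  injective \<open>f\<close> bijective, and then every composite with a labeling is a bijection;
  otherwise no composite is injective.\<close>

lemma lookup_w_poly_ones_vector:
  assumes "finite (verts G)" "finite (verts H)" "card (verts G) = card (verts H)"
  shows "Poly_Mapping.lookup (w_poly G H) (ones_vector (card (verts H))) =
    fact (card (verts H)) * of_nat (card {f \<in> homs G H. inj_on f (verts G)})"
proof -
  let ?n = "card (verts H)"
  have "card {\<phi> \<in> labelings H. weight (verts G) (\<phi> \<circ> f) = ones_vector ?n} =
      (if inj_on f (verts G) then fact ?n else 0)" if f: "f \<in> homs G H" for f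
  proof (cases "inj_on f (verts G)")
    case True
    then have "bij_betw f (verts G) (verts H)"
      using f assms by (auto simp: homs_def intro: bij_betw_of_card_eq)
    then have "{\<phi> \<in> labelings H. weight (verts G) (\<phi> \<circ> f) = ones_vector ?n} = labelings H"
      using assms(1) by (auto simp: weight_eq_ones_vector_iff labelings_def intro: bij_betw_trans)
    then show ?thesis
      using True assms(2) by (simp add: card_labelings)
  next
    case False
    then have "{\<phi> \<in> labelings H. weight (verts G) (\<phi> \<circ> f) = ones_vector ?n} = {}"
      using assms(1) by (auto simp: weight_eq_ones_vector_iff bij_betw_def dest: inj_on_imageI2)
    then show ?thesis
      using False by (simp only: card.empty if_False)
  qed
  then have "(\<Sum>f\<in>homs G H. card {\<phi> \<in> labelings H. weight (verts G) (\<phi> \<circ> f) = ones_vector ?n}) =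
      (\<Sum>f\<in>homs G H. if inj_on f (verts G) then fact ?n else 0)"
    by simp
  also have "\<dots> = fact ?n * card {f \<in> homs G H. inj_on f (verts G)}"
    using finite_homs[OF assms(1,2)] by (simp flip: sum.inter_filter)
  finally show ?thesis
    using assms(1,2) by (simp add: lookup_w_poly del: of_nat_sum)
qed

section \<open>The symmetric function\<close>

lemma w_poly_expansion:
  assumes "finite (verts G)" "finite (verts H)"
  shows "\<exists>c. w_poly G H = (\<Sum>p | p \<in> partitions (card (verts G)) \<and> size p \<le> card (verts H).
    const (c p) * mono_poly (card (verts H)) p)"
proof -
  let ?n = "card (verts H)"
  let ?P = "{p. p \<in> partitions (card (verts G)) \<and> size p \<le> ?n}"
  \<comment> \<open>An arbitrary monomial of each shape supplies the coefficient; by symmetry the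
    choice is immaterial.\<close>
  define rep where "rep p = (SOME \<alpha>. Poly_Mapping.keys \<alpha> \<subseteq> {1..?n} \<and> exponents \<alpha> = p)" for p
  have rep: "Poly_Mapping.keys (rep p) \<subseteq> {1..?n} \<and> exponents (rep p) = p" if "p \<in> ?P" for p
    unfolding rep_def using that by (intro someI_ex[OF ex_exponents]) (auto simp: partitions_def)
  have "w_poly G H = (\<Sum>p\<in>?P. const (Poly_Mapping.lookup (w_poly G H) (rep p)) * mono_poly ?n p)"
  proof (rule poly_mapping_eqI)
    fix \<alpha>
    let ?c = "\<lambda>p. Poly_Mapping.lookup (w_poly G H) (rep p)"
    have "Poly_Mapping.lookup (w_poly G H) \<alpha> =
        (if Poly_Mapping.keys \<alpha> \<subseteq> {1..?n} \<and> exponents \<alpha> \<in> ?P then ?c (exponents \<alpha>) else 0)"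
    proof (cases "Poly_Mapping.keys \<alpha> \<subseteq> {1..?n} \<and> exponents \<alpha> \<in> ?P")
      case True
      then show ?thesis
        using rep[of "exponents \<alpha>"]
          lookup_w_poly_symmetric[OF assms, of \<alpha> "rep (exponents \<alpha>)"] by simp
    next
      case False
      then show ?thesis
        using lookup_w_poly_nonzeroD[OF assms, of \<alpha>] by auto
    qed
    then show "Poly_Mapping.lookup (w_poly G H) \<alpha> =
        Poly_Mapping.lookup (\<Sum>p\<in>?P. const (?c p) * mono_poly ?n p) \<alpha>"
      by (simp add: lookup_sum_mono_poly)
  qed
  then show ?thesis
    by (rule exI[where x = "\<lambda>p. Poly_Mapping.lookup (w_poly G H) (rep p)"])
qed

text \<open>This discharges the definite description in \<open>chrom_sym\<close>: the coefficients
  on admissible shapes are forced, because each such shape occurs among the monomials in n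
  variables.\<close>

lemma chrom_sym_expansion:
  assumes "finite (verts G)" "finite (verts H)"
  obtains c where
    "w_poly G H = (\<Sum>p | p \<in> partitions (card (verts G)) \<and> size p \<le> card (verts H).
       const (c p) * mono_poly (card (verts H)) p)"
    "chrom_sym G H = (\<lambda>\<alpha>. \<Sum>p | p \<in> partitions (card (verts G)) \<and> size p \<le> card (verts H).
       c p * mono_sym p \<alpha>)"
proof -
  let ?n = "card (verts H)"
  let ?P = "{p. p \<in> partitions (card (verts G)) \<and> size p \<le> ?n}"
  obtain c where c: "w_poly G H = (\<Sum>p\<in>?P. const (c p) * mono_poly ?n p)"
    using w_poly_expansion[OF assms] by blast
  have unique: "d p = c p"
    if d: "w_poly G H = (\<Sum>p\<in>?P. const (d p) * mono_poly ?n p)" and p: "p \<in> ?P" for d p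
  proof -
    obtain \<alpha> where \<alpha>: "Poly_Mapping.keys \<alpha> \<subseteq> {1..?n}" "exponents \<alpha> = p"
      using ex_exponents[of p ?n] p by (auto simp: partitions_def)
    have "Poly_Mapping.lookup (w_poly G H) \<alpha> = e p"
      if "w_poly G H = (\<Sum>p\<in>?P. const (e p) * mono_poly ?n p)" for e
      unfolding that using \<alpha> p by (subst lookup_sum_mono_poly) auto
    from this[OF c] this[OF d] show ?thesis
      by simp
  qed
  have "chrom_sym G H = (\<lambda>\<alpha>. \<Sum>p\<in>?P. c p * mono_sym p \<alpha>)"
    unfolding chrom_sym_def
  proof (rule the_equality)
    show "\<exists>d. w_poly G H = (\<Sum>p\<in>?P. const (d p) * mono_poly ?n p) \<and>
        (\<lambda>\<alpha>. \<Sum>p\<in>?P. c p * mono_sym p \<alpha>) = (\<lambda>\<alpha>. \<Sum>p\<in>?P. d p * mono_sym p \<alpha>)"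
      using c by blast
  next
    fix X
    assume "\<exists>d. w_poly G H = (\<Sum>p\<in>?P. const (d p) * mono_poly ?n p) \<and>
        X = (\<lambda>\<alpha>. \<Sum>p\<in>?P. d p * mono_sym p \<alpha>)"
    then obtain d where d: "w_poly G H = (\<Sum>p\<in>?P. const (d p) * mono_poly ?n p)"
        "X = (\<lambda>\<alpha>. \<Sum>p\<in>?P. d p * mono_sym p \<alpha>)"
      by blast
    \<comment> \<open>The functions \<open>c\<close> and \<open>d\<close> may differ off
      \<open>?P\<close>, but the sums see only \<open>?P\<close>.\<close>
    show "X = (\<lambda>\<alpha>. \<Sum>p\<in>?P. c p * mono_sym p \<alpha>)"
      unfolding d(2) using unique[OF d(1)] by (intro ext sum.cong) auto
  qed
  with c show ?thesis
    by (rule that)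
qed

text \<open>Both expansions share their coefficients. The support condition matters:
  \<open>w_poly\<close> has no variables beyond the first n, while the symmetric function can
  contain them.\<close>

lemma chrom_sym_eq_lookup:
  assumes "finite (verts G)" "finite (verts H)" "Poly_Mapping.keys \<alpha> \<subseteq> {1..card (verts H)}"
  shows "chrom_sym G H \<alpha> = Poly_Mapping.lookup (w_poly G H) \<alpha>"
proof -
  obtain c where c:
    "w_poly G H = (\<Sum>p | p \<in> partitions (card (verts G)) \<and> size p \<le> card (verts H).
       const (c p) * mono_poly (card (verts H)) p)"
    "chrom_sym G H = (\<lambda>\<alpha>. \<Sum>p | p \<in> partitions (card (verts G)) \<and> size p \<le> card (verts H).
       c p * mono_sym p \<alpha>)"
    using chrom_sym_expansion[OF assms(1,2)] by blast
  have "Poly_Mapping.keys \<alpha> \<subseteq> {1..}"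
    using assms(3) by auto
  then show ?thesis
    unfolding c using assms(3) by (simp add: lookup_sum_mono_poly sum_mult_mono_sym)
qed

text \<open>Extending the coefficients by 0 to partitions with more than n parts gives an expansion
  over all partitions, the form used in the final claims.\<close>

lemma chrom_sym_ex_partitions_sum:
  assumes "finite (verts G)" "finite (verts H)"
  shows "\<exists>c. chrom_sym G H = (\<lambda>\<alpha>. \<Sum>p\<in>partitions (card (verts G)). c p * mono_sym p \<alpha>) \<and>
    (\<forall>p. size p > card (verts H) \<longrightarrow> c p = 0)"
proof -
  obtain c where c:
    "chrom_sym G H = (\<lambda>\<alpha>. \<Sum>p | p \<in> partitions (card (verts G)) \<and> size p \<le> card (verts H).
       c p * mono_sym p \<alpha>)"
    using chrom_sym_expansion[OF assms] by blast
  define d where "d p = (if size p \<le> card (verts H) then c p else 0)" for p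
  have "chrom_sym G H = (\<lambda>\<alpha>. \<Sum>p\<in>partitions (card (verts G)). d p * mono_sym p \<alpha>)"
    unfolding c by (intro ext sum.mono_neutral_cong_left) (auto simp: d_def)
  then show ?thesis
    by (auto simp: d_def)
qed

lemma chrom_sym_ones_vector_of_sum:
  assumes "chrom_sym G H = (\<lambda>\<alpha>. \<Sum>p\<in>partitions k. c p * mono_sym p \<alpha>)"
  shows "chrom_sym G H (ones_vector k) = c (ones k)"
  unfolding assms
  by (simp add: sum_mult_mono_sym keys_ones_vector exponents_ones_vector ones_in_partitions)

lemma chrom_sym_ones_vector:
  assumes "finite (verts G)" "finite (verts H)" "card (verts G) = card (verts H)"
  shows "chrom_sym G H (ones_vector (card (verts H))) =
    fact (card (verts H)) * of_nat (card {f \<in> homs G H. inj_on f (verts G)})"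
  using assms by (subst chrom_sym_eq_lookup) (auto simp: keys_ones_vector lookup_w_poly_ones_vector)

lemma chrom_sym_ones_vector_eq_0:
  assumes "simple_graph G" "simple_graph H" "\<not> isomorphic G H"
    and "card (verts G) > card (verts H) \<or>
      card (verts G) = card (verts H) \<and> card (edges G) \<ge> card (edges H)"
  shows "chrom_sym G H (ones_vector (card (verts G))) = 0"
proof -
  have fin: "finite (verts G)" "finite (verts H)"
    using assms(1,2) by (auto simp: simple_graph_def)
  show ?thesis
  proof (cases "card (verts G) > card (verts H)")
    \<comment> \<open>The partition into ones has more parts than \<open>H\<close> has vertices, so
      its coefficient is 0 by convention.\<close>
    case True
    then show ?thesis
      using chrom_sym_ex_partitions_sum[OF fin]
      by (metis chrom_sym_ones_vector_of_sum ones_def size_replicate_mset)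
  next
    \<comment> \<open>The vertex counts agree, and an injective homomorphism would be an
      isomorphism.\<close>
    case False
    then have "{f \<in> homs G H. inj_on f (verts G)} = {}"
      using inj_hom_imp_iso[OF assms(1,2)] assms(3,4) by (auto simp: isomorphic_def)
    then show ?thesis
      using chrom_sym_ones_vector[OF fin] False assms(4) by (simp only: card.empty) simp
  qed
qed

text \<open>The isomorphism itself is one of the injective homomorphisms counted.\<close>

lemma chrom_sym_ones_vector_neq_0:
  assumes "finite (verts G)" "finite (verts H)" "graph_iso G H f"
  shows "chrom_sym G H (ones_vector (card (verts G))) \<noteq> 0"
proof -
  have card: "card (verts G) = card (verts H)" and inj: "inj_on f (verts G)"
    using assms(3) by (auto simp: graph_iso_def bij_betw_same_card bij_betw_def)
  define S where "S = {f \<in> homs G H. inj_on f (verts G)}"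
  have "restrict f (verts G) \<in> S" "finite S"
    using graph_iso_imp_hom[OF assms(3)] inj finite_homs[OF assms(1,2)] by (auto simp: S_def)
  then have "card S \<noteq> 0"
    by auto
  then show ?thesis
    using chrom_sym_ones_vector[OF assms(1,2) card] card by (simp add: S_def)
qed

lemma chrom_sym_eq_0_of_degree:
  assumes "finite (verts G)" "finite (verts H)" "sum_mset (exponents \<alpha>) \<noteq> card (verts G)"
  shows "chrom_sym G H \<alpha> = 0"
proof -
  obtain c where "chrom_sym G H = (\<lambda>\<alpha>. \<Sum>p\<in>partitions (card (verts G)). c p * mono_sym p \<alpha>)"
    using chrom_sym_ex_partitions_sum[OF assms(1,2)] by blast
  then show ?thesis
    using assms(3)
    by (simp add: sum_mult_mono_sym) (simp add: partitions_def)
qed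

section \<open>Separating non-isomorphic graphs\<close>

lemma isomorphic_sym:
  assumes "isomorphic G H"
  shows "isomorphic H G"
proof -
  obtain f where f: "bij_betw f (verts G) (verts H)"
      "\<And>u v. u \<in> verts G \<Longrightarrow> v \<in> verts G \<Longrightarrow> adj G u v \<longleftrightarrow> adj H (f u) (f v)"
    using assms by (auto simp: isomorphic_def graph_iso_def)
  have "inv_into (verts G) f x \<in> verts G \<and> f (inv_into (verts G) f x) = x"
    if "x \<in> verts H" for x
    using that f(1) bij_betw_inv_into[OF f(1)]
    by (auto simp: bij_betw_inv_into_right bij_betw_apply)
  then have "graph_iso H G (inv_into (verts G) f)"
    using bij_betw_inv_into[OF f(1)] f(2) by (auto simp: graph_iso_def)
  then show ?thesis
    by (auto simp: isomorphic_def)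
qed

lemma isomorphic_trans:
  assumes "isomorphic G H" "isomorphic H K"
  shows "isomorphic G K"
proof -
  obtain f g where fg: "graph_iso G H f" "graph_iso H K g"
    using assms by (auto simp: isomorphic_def)
  have "f u \<in> verts H" if "u \<in> verts G" for u
    using fg(1) that by (auto simp: graph_iso_def bij_betw_apply)
  then have "graph_iso G K (g \<circ> f)"
    using fg by (auto simp: graph_iso_def intro: bij_betw_trans)
  then show ?thesis
    by (auto simp: isomorphic_def)
qed

text \<open>A copy of \<open>G\<close> itself distinguishes \<open>G\<close> from \<open>K\<close>, through the coefficient of
  $x_1 \cdots x_k$.\<close>

lemma ex_distinguishing_graph:
  assumes "simple_graph G" "simple_graph K" "\<not> isomorphic K G"
    and "card (verts G) \<noteq> card (verts K) \<or> card (edges K) \<ge> card (edges G)"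
  shows "\<exists>H :: nat ugraph. simple_graph H \<and> chrom_sym G H \<noteq> chrom_sym K H"
proof -
  obtain H :: "nat ugraph" and f where H: "simple_graph H" "card (verts H) = card (verts G)"
      "card (edges H) = card (edges G)" "graph_iso G H f"
    using ex_nat_copy[OF assms(1)] by blast
  have fin: "finite (verts G)" "finite (verts K)" "finite (verts H)"
    using assms(1,2) H(1) by (auto simp: simple_graph_def)
  let ?\<alpha> = "ones_vector (card (verts G))"
  have "chrom_sym K H ?\<alpha> = 0"
  \<comment> \<open>With equal vertex counts the vanishing result applies to \<open>K\<close> and
    the copy \<open>H\<close>; otherwise \<open>chrom_sym K H\<close> is homogeneous of a degree
    other than that of the monomial.\<close>
  proof (cases "card (verts G) = card (verts K)")
    case True
    have "isomorphic H G"
      by (rule isomorphic_sym) (use H(4) in \<open>auto simp: isomorphic_def\<close>)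
    then have "\<not> isomorphic K H"
      using assms(3) isomorphic_trans by blast
    then show ?thesis
      using chrom_sym_ones_vector_eq_0[OF assms(2) H(1)] True H(2,3) assms(4) by simp
  next
    case False
    then show ?thesis
      using fin by (intro chrom_sym_eq_0_of_degree) (auto simp: exponents_ones_vector ones_def)
  qed
  moreover have "chrom_sym G H ?\<alpha> \<noteq> 0"
    by (rule chrom_sym_ones_vector_neq_0[OF fin(1,3) H(4)])
  ultimately show ?thesis
    using H(1) by (intro exI[of _ H]) auto
qed

section \<open>Augmented monomials and the three claims\<close>

definition aug_factor :: "nat \<Rightarrow> nat multiset \<Rightarrow> rat" where
  "aug_factor n p = (\<Prod>i = 1..sum_mset p. fact (count p i)) * fact (n - size p)"

lemma aug_mono_sym_eq: "aug_mono_sym n p \<alpha> = aug_factor n p * mono_sym p \<alpha>"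
  by (simp add: aug_mono_sym_def aug_factor_def)

text \<open>Division by this factor converts a monomial expansion into an augmented one.\<close>

lemma aug_factor_neq_0: "aug_factor n p \<noteq> 0"
  by (simp add: aug_factor_def)

text \<open>The multiplicity of the part 1 contributes k!, every other multiplicity contributes 0! =
  1, and the last factor is (k - k)! = 1.\<close>

lemma aug_factor_ones: "aug_factor k (ones k) = fact k"
proof (cases k)
  case (Suc m)
  have "(\<Prod>i = 1..k. fact (count (ones k) i)) = (\<Prod>i = 1..k. if i = 1 then fact k else (1::rat))"
    by (intro prod.cong) (auto simp: ones_def)
  also have "\<dots> = fact k"
    using Suc by (subst prod.delta) auto
  finally show ?thesis
    by (simp add: aug_factor_def ones_def)
qed (simp add: aug_factor_def ones_def)

theorem corollary3p22:
  fixes G1 :: "'a ugraph" and G2 :: "'b ugraph" and k1 k2 :: nat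
  assumes "simple_graph G1" and "simple_graph G2"
    and "\<not> isomorphic G1 G2"
    and "card (verts G1) = k1" and "card (verts G2) = k2"
  shows "((\<exists>c. chrom_sym G1 G1 = (\<lambda>\<alpha>. \<Sum>p\<in>partitions k1. c p * aug_mono_sym k1 p \<alpha>)) \<and>
          (\<forall>c. chrom_sym G1 G1 = (\<lambda>\<alpha>. \<Sum>p\<in>partitions k1. c p * aug_mono_sym k1 p \<alpha>) \<longrightarrow>
               c (ones k1) = of_nat (card (automorphisms G1)))) \<and>
         ((\<exists>c. chrom_sym G1 G2 = (\<lambda>\<alpha>. \<Sum>p\<in>partitions k1. c p * mono_sym p \<alpha>)) \<and>
          (\<forall>c. chrom_sym G1 G2 = (\<lambda>\<alpha>. \<Sum>p\<in>partitions k1. c p * mono_sym p \<alpha>) \<longrightarrow>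
               (k1 > k2 \<or> k1 = k2 \<and> card (edges G1) \<ge> card (edges G2)) \<longrightarrow>
               c (ones k1) = 0)) \<and>
         (\<exists>H :: nat ugraph. simple_graph H \<and> chrom_sym G1 H \<noteq> chrom_sym G2 H)"
proof (intro conjI allI impI)
  have fin: "finite (verts G1)" "finite (verts G2)"
    using assms(1,2) by (auto simp: simple_graph_def)
  obtain c where "chrom_sym G1 G1 = (\<lambda>\<alpha>. \<Sum>p\<in>partitions k1. c p * mono_sym p \<alpha>)"
    using chrom_sym_ex_partitions_sum[OF fin(1) fin(1)] assms(4) by blast
  then have "chrom_sym G1 G1 =
      (\<lambda>\<alpha>. \<Sum>p\<in>partitions k1. (c p / aug_factor k1 p) * aug_mono_sym k1 p \<alpha>)"
    by (simp add: aug_mono_sym_eq aug_factor_neq_0)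
  then show "\<exists>c. chrom_sym G1 G1 = (\<lambda>\<alpha>. \<Sum>p\<in>partitions k1. c p * aug_mono_sym k1 p \<alpha>)"
    by (rule exI[where x = "\<lambda>p. c p / aug_factor k1 p"])
  show "c (ones k1) = of_nat (card (automorphisms G1))"
    if "chrom_sym G1 G1 = (\<lambda>\<alpha>. \<Sum>p\<in>partitions k1. c p * aug_mono_sym k1 p \<alpha>)" for c
  proof -
    have "chrom_sym G1 G1 =
        (\<lambda>\<alpha>. \<Sum>p\<in>partitions k1. (c p * aug_factor k1 p) * mono_sym p \<alpha>)"
      using that by (simp add: aug_mono_sym_eq mult.assoc)
    \<comment> \<open>The k! from the augmented normalization cancels the k! labelings counted by
      the same value.\<close>
    then have "chrom_sym G1 G1 (ones_vector k1) = c (ones k1) * fact k1"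
      using chrom_sym_ones_vector_of_sum aug_factor_ones by metis
    moreover have "chrom_sym G1 G1 (ones_vector k1) = fact k1 * of_nat (card (automorphisms G1))"
      using chrom_sym_ones_vector[OF fin(1) fin(1)] assms(4) automorphisms_eq_inj_homs[OF assms(1)]
      by simp
    ultimately show ?thesis
      by simp
  qed
  show "\<exists>c. chrom_sym G1 G2 = (\<lambda>\<alpha>. \<Sum>p\<in>partitions k1. c p * mono_sym p \<alpha>)"
    using chrom_sym_ex_partitions_sum[OF fin] assms(4) by blast
  show "c (ones k1) = 0"
    if "chrom_sym G1 G2 = (\<lambda>\<alpha>. \<Sum>p\<in>partitions k1. c p * mono_sym p \<alpha>)"
      and "k1 > k2 \<or> k1 = k2 \<and> card (edges G1) \<ge> card (edges G2)" for c
    using chrom_sym_ones_vector_eq_0[OF assms(1-3)] chrom_sym_ones_vector_of_sum[OF that(1)]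
      that(2) assms(4,5) by simp
  show "\<exists>H :: nat ugraph. simple_graph H \<and> chrom_sym G1 H \<noteq> chrom_sym G2 H"
  \<comment> \<open>When the vertex counts agree, the graph with no more edges than the other is the
    one to copy, so that the vanishing result applies to the other.\<close>
  proof (cases "card (verts G1) \<noteq> card (verts G2) \<or> card (edges G2) \<ge> card (edges G1)")
    case True
    then show ?thesis
      using ex_distinguishing_graph[OF assms(1,2)] assms(3) isomorphic_sym by blast
  next
    case False
    then show ?thesis
      using ex_distinguishing_graph[OF assms(2,1,3)] by fastforce
  qed
qed

end
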